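(* Let $P=\bigcap_{i=1}^N\{x\in\mathbb R^n:l_i(x)>0\}$ be a convex polytope in $\mathbb R^n$, where $l_1,\dots,l_N$ are affine functions, and let $0<h\in C^\infty(\overline P)$. If there exists a function $u$ with $$\det D^2u=\frac{h(x)}{\prod_{i=1}^Nl_i(x)}\ \text{ in }P,\qquad u(x)-\sum_{i=1}^Nl_i(x)\ln l_i(x)\in C^\infty(\overline P),$$ then $P$ is a simple convex polytope.
   Context: A polytope in $\mathbb R^n$ is called simple if every vertex is contained in exactly $n$ (the minimal possible number) codimension-one faces. The affine functions $l_1,\dots,l_N$ define the codimension-one faces of $P$. $h>0$ on $\overline P$, and $C^\infty(\overline P)$ denotes functions smooth up to the boundary of $P$. *)

theory Defs
  imports "HOL-Analysis.Analysis"
begin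

definition affine_function :: "('a::real_inner \<Rightarrow> real) \<Rightarrow> bool"
  where "affine_function f \<longleftrightarrow> (\<exists>a b. \<forall>x. f x = a \<bullet> x + b)"

definition has_partial_derivative ::
    "(real ^ 'n \<Rightarrow> real) \<Rightarrow> 'n \<Rightarrow> real \<Rightarrow> real ^ 'n \<Rightarrow> bool"
  where "has_partial_derivative f i d x \<longleftrightarrow>
    ((\<lambda>t. f (x + t *\<^sub>R axis i 1)) has_real_derivative d) (at 0)"

text \<open>
  Defined through the total operator \<open>deriv\<close>, hence meaningful only where the derivatives exist. This
  is so throughout \<open>P\<close> for the Hessian of any \<open>u\<close> that differs on \<open>P\<close> from a smooth function by a
  function smooth up to the boundary of \<open>P\<close>.
\<close>

definition partial_derivative :: "'n \<Rightarrow> (real ^ 'n \<Rightarrow> real) \<Rightarrow> real ^ 'n \<Rightarrow> real"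
  where "partial_derivative i f x = deriv (\<lambda>t. f (x + t *\<^sub>R axis i 1)) 0"

definition hessian :: "(real ^ 'n \<Rightarrow> real) \<Rightarrow> real ^ 'n \<Rightarrow> real ^ 'n ^ 'n"
  where "hessian f x = (\<chi> i j. partial_derivative i (partial_derivative j f) x)"

text \<open>
  The space of functions on the closure of an open set \<open>P\<close> that are \<open>k\<close> times continuously
  differentiable up to the boundary: the partial derivatives of order at most \<open>k\<close> exist
  in \<open>P\<close> and extend continuously to the closure. The function \<open>g\<close> below is the continuous extension
  of the \<open>i\<close>-th partial derivative of \<open>f\<close>. Only the values on the closure matter.
\<close>

primrec Ck_closure :: "nat \<Rightarrow> (real ^ 'n) set \<Rightarrow> (real ^ 'n \<Rightarrow> real) \<Rightarrow> bool"
  where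
    "Ck_closure 0 P f \<longleftrightarrow> continuous_on (closure P) f"
  | "Ck_closure (Suc k) P f \<longleftrightarrow> continuous_on (closure P) f \<and>
      (\<forall>i. \<exists>g. Ck_closure k P g \<and> (\<forall>x\<in>P. has_partial_derivative f i (g x) x))"

definition smooth_closure :: "(real ^ 'n) set \<Rightarrow> (real ^ 'n \<Rightarrow> real) \<Rightarrow> bool"
  where "smooth_closure P f \<longleftrightarrow> (\<forall>k. Ck_closure k P f)"

text \<open>
  The condition \<open>interior S \<noteq> {}\<close> says that \<open>S\<close> is full-dimensional, so that the facets of \<open>S\<close> are
  its faces of codimension one in the ambient space.
\<close>

definition simple_polytope :: "(real ^ 'n) set \<Rightarrow> bool"
  where "simple_polytope S \<longleftrightarrow> polytope S \<and> interior S \<noteq> {} \<and>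
    (\<forall>v. v extreme_point_of S \<longrightarrow> card {F. F facet_of S \<and> v \<in> F} = CARD('n))"

text \<open>
  The open polytope \<open>P\<close> is cut out by the affine functions \<open>l 1, \<dots>, l N\<close>, one for each facet of its
  closure. The library's notions of polytope and facet concern the closed polytope.
\<close>

definition polytope_defined_by ::
    "(real ^ 'n) set \<Rightarrow> nat \<Rightarrow> (nat \<Rightarrow> real ^ 'n \<Rightarrow> real) \<Rightarrow> bool"
  where "polytope_defined_by P N l \<longleftrightarrow>
    (\<forall>i\<in>{1..N}. affine_function (l i)) \<and>
    P = (\<Inter>i\<in>{1..N}. {x. l i x > 0}) \<and>
    P \<noteq> {} \<and> polytope (closure P) \<and>
    bij_betw (\<lambda>i. {x \<in> closure P. l i x = 0}) {1..N} {F. F facet_of closure P}"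

end

theory Submission
  imports Defs
begin

text \<open>
  Let \<open>v\<close> be a vertex of the closed polytope in dimension \<open>n\<close> and \<open>m\<close> the number of facets through \<open>v\<close>. That
  \<open>m \<ge> n\<close> holds in every polytope: if fewer than \<open>n\<close> of the functions \<open>l i\<close> vanished at \<open>v\<close>, some
  nonzero direction would be orthogonal to all their gradients, and \<open>v\<close> would be the midpoint of a
  segment inside the polytope (lemma \<open>dim_le_card_active_constraints\<close>).

  The equation gives \<open>m \<le> n\<close>, by comparing orders of blow-up along a ray \<open>v + t w\<close>, \<open>t \<rightarrow> 0+\<close>, from
  \<open>v\<close> into the interior. The Hessian of \<open>u\<close> is the sum of the rank-one matrices
  \<open>\<nabla>l\<^sub>k \<nabla>l\<^sub>k\<^sup>T / l\<^sub>k\<close> and of a matrix that stays bounded up to the boundary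
  (lemma \<open>hessian_guillemin_potential\<close>). On the ray each \<open>l\<^sub>k\<close> either is a positive multiple of \<open>t\<close>
  or stays away from \<open>0\<close>, so \<open>t\<close> times the Hessian converges, and \<open>t\<^sup>n det D\<^sup>2u\<close> with it. The right
  side \<open>h / \<Prod>l\<^sub>k\<close>, on the other hand, has exact order \<open>t\<^sup>-\<^sup>m\<close>, because exactly \<open>m\<close> of the factors
  vanish at \<open>v\<close> and \<open>h\<close> is positive there. Hence \<open>m \<le> n\<close>.
\<close>

section \<open>Vertices of polyhedra\<close>

text \<open>
  If the gradients of the active constraints did not span, moving slightly in either sense along a
  direction orthogonal to them would keep the active constraints at \<open>0\<close> and the others positive.
\<close>

lemma dim_le_card_active_constraints:
  fixes a :: "'i \<Rightarrow> 'a::euclidean_space"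
  assumes fin: "finite I"
    and S: "S = {x. \<forall>i\<in>I. 0 \<le> a i \<bullet> x + b i}"
    and v: "v extreme_point_of S"
  shows "DIM('a) \<le> card {i\<in>I. a i \<bullet> v + b i = 0}"
proof (rule ccontr)
  define J where "J = {i\<in>I. a i \<bullet> v + b i = 0}"
  assume "\<not> DIM('a) \<le> card {i\<in>I. a i \<bullet> v + b i = 0}"
  then have less: "card J < DIM('a)"
    by (simp add: J_def)
  have finJ: "finite J"
    using fin by (simp add: J_def)
  have "dim (a ` J) \<le> card (a ` J)"
    using finJ by (intro dim_le_card') auto
  also have "\<dots> \<le> card J"
    using finJ by (rule card_image_le)
  finally have "dim (a ` J) < DIM('a)"
    using less by simp
  then have "span (a ` J) \<noteq> UNIV"
    by (metis dim_UNIV dim_span less_irrefl)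
  then obtain w where w: "w \<noteq> 0" "\<And>x. x \<in> span (a ` J) \<Longrightarrow> w \<bullet> x = 0"
    using span_not_UNIV_orthogonal by blast
  have vS: "v \<in> S"
    using v by (simp add: extreme_point_of_def)
  have stays: "\<forall>\<^sub>F t in at_right 0. v + t *\<^sub>R z \<in> S"
    if z: "\<And>x. x \<in> span (a ` J) \<Longrightarrow> z \<bullet> x = 0" for z
  proof -
    have "\<forall>\<^sub>F t in at_right 0. 0 \<le> a i \<bullet> (v + t *\<^sub>R z) + b i" if i: "i \<in> I" for i
    proof (cases "i \<in> J")
      case True
      then have "a i \<bullet> z = 0"
        using z[of "a i"] by (simp add: span_base inner_commute)
      then show ?thesis
        using True by (simp add: J_def inner_add_right)
    next
      case False
      then have "0 < a i \<bullet> v + b i"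
        using vS i by (force simp: S J_def)
      moreover have "((\<lambda>t. a i \<bullet> (v + t *\<^sub>R z) + b i) \<longlongrightarrow> a i \<bullet> (v + 0 *\<^sub>R z) + b i) (at_right 0)"
        by (intro tendsto_intros)
      ultimately have "\<forall>\<^sub>F t in at_right 0. 0 < a i \<bullet> (v + t *\<^sub>R z) + b i"
        by (simp add: order_tendstoD(1))
      then show ?thesis
        by (rule eventually_mono) simp
    qed
    then have "\<forall>\<^sub>F t in at_right 0. \<forall>i\<in>I. 0 \<le> a i \<bullet> (v + t *\<^sub>R z) + b i"
      using fin by (intro eventually_ball_finite) auto
    then show ?thesis
      by (simp add: S)
  qed
  have "\<forall>\<^sub>F t in at_right (0::real). v + t *\<^sub>R w \<in> S \<and> v + t *\<^sub>R (- w) \<in> S \<and> 0 < t"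
    using stays[of w] stays[of "- w"] w(2)
    by (intro eventually_conj eventually_at_right_less) auto
  then obtain t :: real where t: "v + t *\<^sub>R w \<in> S" "v - t *\<^sub>R w \<in> S" "0 < t"
    using eventually_happens[of _ "at_right (0::real)"] by auto
  have "v = midpoint (v - t *\<^sub>R w) (v + t *\<^sub>R w)"
    by (simp add: midpoint_def flip: scaleR_2)
  moreover have "v - t *\<^sub>R w \<noteq> v + t *\<^sub>R w"
    using t(3) w(1) by (simp add: algebra_simps flip: scaleR_2)
  ultimately have "v \<in> open_segment (v - t *\<^sub>R w) (v + t *\<^sub>R w)"
    by (metis midpoint_in_open_segment)
  then show False
    using v t by (auto simp: extreme_point_of_def)
qed

lemma ray_in_open_polyhedron:
  fixes a :: "'i \<Rightarrow> 'a::real_inner"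
  assumes x: "\<forall>i\<in>I. 0 \<le> a i \<bullet> x + b i" and p: "\<forall>i\<in>I. 0 < a i \<bullet> p + b i"
    and t: "0 < t" "t \<le> 1"
  shows "\<forall>i\<in>I. 0 < a i \<bullet> (x + t *\<^sub>R (p - x)) + b i"
proof
  fix i assume i: "i \<in> I"
  have "a i \<bullet> (x + t *\<^sub>R (p - x)) + b i = (1 - t) * (a i \<bullet> x + b i) + t * (a i \<bullet> p + b i)"
    by (simp add: algebra_simps inner_add_right inner_diff_right)
  also have "\<dots> > 0"
    using x p t i
    by (intro add_nonneg_pos[of "(1 - t) * (a i \<bullet> x + b i)"] mult_nonneg_nonneg mult_pos_pos) auto
  finally show "0 < a i \<bullet> (x + t *\<^sub>R (p - x)) + b i" .
qed

lemma tendsto_ray: "((\<lambda>t. x + t *\<^sub>R w) \<longlongrightarrow> x) (at_right 0)" for x w :: "'a::real_normed_vector"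
  by (auto intro!: tendsto_eq_intros)

lemma open_strict_polyhedron:
  fixes a :: "'i \<Rightarrow> 'a::real_inner"
  assumes "finite I"
  shows "open {x. \<forall>i\<in>I. 0 < a i \<bullet> x + b i}"
proof -
  have "open (\<Inter>i\<in>I. {x. 0 < a i \<bullet> x + b i})"
    using assms by (intro open_INT ballI open_Collect_less continuous_intros)
  also have "(\<Inter>i\<in>I. {x. 0 < a i \<bullet> x + b i}) = {x. \<forall>i\<in>I. 0 < a i \<bullet> x + b i}"
    by auto
  finally show ?thesis .
qed

lemma closure_open_polyhedron:
  fixes a :: "'i \<Rightarrow> 'a::euclidean_space"
  assumes P: "P = {x. \<forall>i\<in>I. 0 < a i \<bullet> x + b i}" and ne: "P \<noteq> {}"
  shows "closure P = {x. \<forall>i\<in>I. 0 \<le> a i \<bullet> x + b i}"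
proof
  have "closed (\<Inter>i\<in>I. {x. 0 \<le> a i \<bullet> x + b i})"
    by (intro closed_INT ballI closed_Collect_le continuous_intros)
  also have "(\<Inter>i\<in>I. {x. 0 \<le> a i \<bullet> x + b i}) = {x. \<forall>i\<in>I. 0 \<le> a i \<bullet> x + b i}"
    by auto
  finally show "closure P \<subseteq> {x. \<forall>i\<in>I. 0 \<le> a i \<bullet> x + b i}"
    by (intro closure_minimal) (auto simp: P intro: less_imp_le)
next
  obtain p where p: "\<forall>i\<in>I. 0 < a i \<bullet> p + b i"
    using ne P by auto
  show "{x. \<forall>i\<in>I. 0 \<le> a i \<bullet> x + b i} \<subseteq> closure P"
  proof
    fix x assume "x \<in> {x. \<forall>i\<in>I. 0 \<le> a i \<bullet> x + b i}"
    then have x: "\<forall>i\<in>I. 0 \<le> a i \<bullet> x + b i"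
      by simp
    have "\<forall>\<^sub>F t in at_right 0. x + t *\<^sub>R (p - x) \<in> closure P"
      unfolding eventually_at_right_field
      using ray_in_open_polyhedron[OF x p]
      by (intro exI[of _ 1]) (auto simp: P intro!: subsetD[OF closure_subset])
    then show "x \<in> closure P"
      by (intro Lim_in_closed_set[OF closed_closure _ _ tendsto_ray]) auto
  qed
qed

section \<open>The Hessian of a function with logarithmic boundary behaviour\<close>

lemma has_partial_derivative_cong_open:
  assumes P: "open P" "x \<in> P" and eq: "\<And>y. y \<in> P \<Longrightarrow> f y = g y"
    and g: "has_partial_derivative g i d x"
  shows "has_partial_derivative f i d x"
proof -
  have "open ((\<lambda>t. x + t *\<^sub>R axis i 1) -` P)"
    by (intro open_vimage P continuous_intros)
  then show ?thesis
    unfolding has_partial_derivative_def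
    by (rule has_field_derivative_transform_within_open[OF g[unfolded has_partial_derivative_def]])
      (auto simp: P eq)
qed

lemma partial_derivative_eqI: "has_partial_derivative f i d x \<Longrightarrow> partial_derivative i f x = d"
  by (simp add: has_partial_derivative_def partial_derivative_def DERIV_imp_deriv)

text \<open>
  Two differentiations turn \<open>l ln l\<close> into \<open>\<nabla>l \<nabla>l\<^sup>T / l\<close>, since \<open>(s ln s)'' = 1 / s\<close>. The smooth part
  contributes a remainder \<open>G\<close> whose continuity on the closure is what bounds it near the boundary.
\<close>

lemma hessian_guillemin_potential:
  fixes P :: "(real ^ 'n) set" and a :: "'i \<Rightarrow> real ^ 'n"
  assumes P: "open P" and pos: "\<And>x k. x \<in> P \<Longrightarrow> k \<in> I \<Longrightarrow> 0 < a k \<bullet> x + b k"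
    and \<phi>: "Ck_closure 2 P \<phi>"
    and u: "\<And>x. x \<in> P \<Longrightarrow> u x = (\<Sum>k\<in>I. (a k \<bullet> x + b k) * ln (a k \<bullet> x + b k)) + \<phi> x"
  obtains G where "\<And>i j. continuous_on (closure P) (G i j)"
    and "\<And>i j x. x \<in> P \<Longrightarrow>
      hessian u x $ i $ j = (\<Sum>k\<in>I. a k $ i * a k $ j / (a k \<bullet> x + b k)) + G i j x"
proof -
  have "\<forall>j. \<exists>g. Ck_closure 1 P g \<and> (\<forall>x\<in>P. has_partial_derivative \<phi> j (g x) x)"
    using \<phi> by (simp add: numeral_2_eq_2)
  then obtain g where g: "\<And>j. Ck_closure 1 P (g j)"
      "\<And>j x. x \<in> P \<Longrightarrow> has_partial_derivative \<phi> j (g j x) x"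
    by metis
  have "\<forall>i j. \<exists>G. continuous_on (closure P) G \<and>
      (\<forall>x\<in>P. has_partial_derivative (g j) i (G x) x)"
    using g(1) by simp
  then obtain G where G: "\<And>i j. continuous_on (closure P) (G i j)"
      "\<And>i j x. x \<in> P \<Longrightarrow> has_partial_derivative (g j) i (G i j x) x"
    by metis
  define D where "D = (\<lambda>j x. (\<Sum>k\<in>I. a k $ j * (ln (a k \<bullet> x + b k) + 1)) + g j x)"
  have first: "partial_derivative j u x = D j x" if x: "x \<in> P" for j x
  proof -
    have "has_partial_derivative
        (\<lambda>x. (\<Sum>k\<in>I. (a k \<bullet> x + b k) * ln (a k \<bullet> x + b k)) + \<phi> x) j (D j x) x"
      unfolding has_partial_derivative_def D_def
    proof (intro DERIV_add DERIV_sum)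
      show "((\<lambda>t. \<phi> (x + t *\<^sub>R axis j 1)) has_real_derivative g j x) (at 0)"
        using g(2)[OF x] by (simp add: has_partial_derivative_def)
      fix k assume "k \<in> I"
      then have "0 < a k \<bullet> x + b k"
        using pos x by simp
      then show "((\<lambda>t. (a k \<bullet> (x + t *\<^sub>R axis j 1) + b k) * ln (a k \<bullet> (x + t *\<^sub>R axis j 1) + b k))
          has_real_derivative a k $ j * (ln (a k \<bullet> x + b k) + 1)) (at 0)"
        unfolding inner_add_right inner_scaleR_right inner_axis
        by (auto intro!: derivative_eq_intros simp: distrib_left[of "a k $ j" "ln (a k \<bullet> x + b k)" 1])
    qed
    then show ?thesis
      by (intro partial_derivative_eqI has_partial_derivative_cong_open[OF P x u])
  qed
  have second: "partial_derivative i (partial_derivative j u) x =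
      (\<Sum>k\<in>I. a k $ i * a k $ j / (a k \<bullet> x + b k)) + G i j x" if x: "x \<in> P" for i j x
  proof -
    have "has_partial_derivative (D j) i
        ((\<Sum>k\<in>I. a k $ i * a k $ j / (a k \<bullet> x + b k)) + G i j x) x"
      unfolding has_partial_derivative_def D_def
    proof (intro DERIV_add DERIV_sum)
      show "((\<lambda>t. g j (x + t *\<^sub>R axis i 1)) has_real_derivative G i j x) (at 0)"
        using G(2)[OF x] by (simp add: has_partial_derivative_def)
      fix k assume "k \<in> I"
      then have "0 < a k \<bullet> x + b k"
        using pos x by simp
      then show "((\<lambda>t. a k $ j * (ln (a k \<bullet> (x + t *\<^sub>R axis i 1) + b k) + 1))
          has_real_derivative a k $ i * a k $ j / (a k \<bullet> x + b k)) (at 0)"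
        unfolding inner_add_right inner_scaleR_right inner_axis
        by (auto intro!: derivative_eq_intros simp: field_simps)
    qed
    then show ?thesis
      by (intro partial_derivative_eqI has_partial_derivative_cong_open[OF P x first])
  qed
  show ?thesis
    by (rule that[OF G(1)]) (simp_all add: hessian_def second)
qed

section \<open>Orders of blow-up at a vertex\<close>

lemma tendsto_det:
  fixes A :: "'b \<Rightarrow> real ^ 'n ^ 'n"
  assumes "\<And>i j. ((\<lambda>t. A t $ i $ j) \<longlongrightarrow> B $ i $ j) F"
  shows "((\<lambda>t. det (A t)) \<longlongrightarrow> det B) F"
  unfolding det_def by (intro tendsto_intros assms)

lemma det_scaleR: "det (t *\<^sub>R A) = t ^ CARD('n) * det A" for A :: "real ^ 'n ^ 'n"
  by (simp add: det_def prod.distrib sum_distrib_left mult_ac)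

text \<open>
  Along the ray a factor that vanishes at \<open>v\<close> equals \<open>t\<close> times the positive slope \<open>a i \<bullet> w\<close>, and any
  other factor has a positive limit. So the product vanishes to order exactly \<open>card J\<close>.
\<close>

lemma tendsto_prod_affine_ray:
  fixes a :: "'i \<Rightarrow> 'a::real_inner"
  assumes fin: "finite I"
    and pos: "\<And>i. i \<in> I \<Longrightarrow> 0 \<le> a i \<bullet> v + b i" "\<And>i. i \<in> I \<Longrightarrow> 0 < a i \<bullet> (v + w) + b i"
    and J: "J = {i\<in>I. a i \<bullet> v + b i = 0}"
  obtains c where "0 < c"
    and "((\<lambda>t. (\<Prod>i\<in>I. a i \<bullet> (v + t *\<^sub>R w) + b i) / t ^ card J) \<longlongrightarrow> c) (at_right 0)"
proof -
  let ?c = "(\<Prod>i\<in>J. a i \<bullet> w) * (\<Prod>i\<in>I - J. a i \<bullet> v + b i)"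
  have "0 < a i \<bullet> w" if "i \<in> J" for i
    using that pos(2)[of i] by (simp add: J inner_add_right)
  moreover have "0 < a i \<bullet> v + b i" if "i \<in> I - J" for i
    using that pos(1)[of i] by (auto simp: J)
  ultimately have "0 < ?c"
    by (intro mult_pos_pos prod_pos) auto
  moreover have "((\<lambda>t. (\<Prod>i\<in>I. a i \<bullet> (v + t *\<^sub>R w) + b i) / t ^ card J) \<longlongrightarrow> ?c) (at_right 0)"
  proof (rule Lim_transform_eventually)
    show "((\<lambda>t. (\<Prod>i\<in>J. a i \<bullet> w) * (\<Prod>i\<in>I - J. a i \<bullet> (v + t *\<^sub>R w) + b i)) \<longlongrightarrow> ?c) (at_right 0)"
      by (intro tendsto_intros tendsto_ray)
    have "(\<Prod>i\<in>J. a i \<bullet> w) * (\<Prod>i\<in>I - J. a i \<bullet> (v + t *\<^sub>R w) + b i)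
        = (\<Prod>i\<in>I. a i \<bullet> (v + t *\<^sub>R w) + b i) / t ^ card J" if "0 < t" for t
    proof -
      have "(\<Prod>i\<in>I. a i \<bullet> (v + t *\<^sub>R w) + b i) =
          (\<Prod>i\<in>J. a i \<bullet> (v + t *\<^sub>R w) + b i) * (\<Prod>i\<in>I - J. a i \<bullet> (v + t *\<^sub>R w) + b i)"
        using fin by (subst mult.commute, intro prod.subset_diff) (auto simp: J)
      also have "(\<Prod>i\<in>J. a i \<bullet> (v + t *\<^sub>R w) + b i) = (\<Prod>i\<in>J. t * (a i \<bullet> w))"
        by (intro prod.cong) (auto simp: J inner_add_right)
      finally show ?thesis
        using that by (simp add: prod.distrib)
    qed
    then show "\<forall>\<^sub>F t in at_right 0. (\<Prod>i\<in>J. a i \<bullet> w) * (\<Prod>i\<in>I - J. a i \<bullet> (v + t *\<^sub>R w) + b i)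
        = (\<Prod>i\<in>I. a i \<bullet> (v + t *\<^sub>R w) + b i) / t ^ card J"
      by (auto simp: eventually_at_right_field intro: exI[of _ 1])
  qed
  ultimately show ?thesis
    by (rule that)
qed

text \<open>
  The comparison of orders. At the point \<open>v + t w\<close> of a ray from \<open>v\<close> into \<open>P\<close> the Hessian blows up
  at most like \<open>1 / t\<close>, hence its determinant at most like \<open>t\<^sup>-\<^sup>n\<close>, whereas \<open>h\<close> over the product
  of the constraints gains a factor \<open>1 / t\<close> for each constraint that is active at \<open>v\<close>.
\<close>

lemma card_active_constraints_le_dim:
  fixes P :: "(real ^ 'n) set" and a :: "'i \<Rightarrow> real ^ 'n"
  assumes fin: "finite I" and P: "P = {x. \<forall>i\<in>I. 0 < a i \<bullet> x + b i}" and ne: "P \<noteq> {}"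
    and v: "v \<in> closure P"
    and h: "continuous_on (closure P) h" "0 < h v"
    and \<phi>: "Ck_closure 2 P \<phi>"
    and u: "\<And>x. x \<in> P \<Longrightarrow> u x = (\<Sum>k\<in>I. (a k \<bullet> x + b k) * ln (a k \<bullet> x + b k)) + \<phi> x"
    and MA: "\<And>x. x \<in> P \<Longrightarrow> det (hessian u x) = h x / (\<Prod>k\<in>I. a k \<bullet> x + b k)"
  shows "card {k\<in>I. a k \<bullet> v + b k = 0} \<le> CARD('n)"
proof (rule ccontr)
  define J where "J = {k\<in>I. a k \<bullet> v + b k = 0}"
  assume "\<not> card {k\<in>I. a k \<bullet> v + b k = 0} \<le> CARD('n)"
  then have less: "CARD('n) < card J"
    by (simp add: J_def)
  have vI: "\<forall>i\<in>I. 0 \<le> a i \<bullet> v + b i"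
    using v closure_open_polyhedron[OF P ne] by auto
  obtain p where p: "\<forall>i\<in>I. 0 < a i \<bullet> p + b i"
    using ne P by auto
  define w where "w = p - v"
  define r where "r t = v + t *\<^sub>R w" for t
  have rP: "r t \<in> P" if "0 < t" "t \<le> 1" for t
    using ray_in_open_polyhedron[OF vI p that] by (simp add: P r_def w_def)
  have evP: "\<forall>\<^sub>F t in at_right 0. 0 < t \<and> r t \<in> P"
    using rP by (auto simp: eventually_at_right_field intro: exI[of _ 1])
  have r0: "(r \<longlongrightarrow> v) (at_right 0)"
    unfolding r_def by (rule tendsto_ray)
  \<comment> \<open>A function continuous on the closure has its value at \<open>v\<close> as the limit along the ray.\<close>
  have along: "((\<lambda>t. f (r t)) \<longlongrightarrow> f v) (at_right 0)" if "continuous_on (closure P) f" for f :: "_ \<Rightarrow> real"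
    using evP closure_subset[of P]
    by (intro continuous_on_tendsto_compose[OF that r0 v]) (auto elim: eventually_mono)
  have "open P"
    unfolding P using fin by (rule open_strict_polyhedron)
  then obtain G where G: "\<And>i j. continuous_on (closure P) (G i j)"
    and H: "\<And>i j x. x \<in> P \<Longrightarrow>
      hessian u x $ i $ j = (\<Sum>k\<in>I. a k $ i * a k $ j / (a k \<bullet> x + b k)) + G i j x"
    using hessian_guillemin_potential[of P I a b \<phi> u] \<phi> u P by auto
  define B :: "real ^ 'n ^ 'n"
    where "B = (\<chi> i j. \<Sum>k\<in>J. a k $ i * a k $ j / (a k \<bullet> w))"
  have "((\<lambda>t. (t *\<^sub>R hessian u (r t)) $ i $ j) \<longlongrightarrow> B $ i $ j) (at_right 0)" for i j
  proof (rule Lim_transform_eventually)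
    let ?e = "\<lambda>t k. a k $ i * a k $ j * (t / (a k \<bullet> r t + b k))"
    have "((\<lambda>t. t / (a k \<bullet> r t + b k)) \<longlongrightarrow> (if k \<in> J then 1 / (a k \<bullet> w) else 0)) (at_right 0)"
      if k: "k \<in> I" for k
    proof (cases "k \<in> J")
      case True
      then have "a k \<bullet> r t + b k = t * (a k \<bullet> w)" for t
        by (simp add: J_def r_def inner_add_right)
      then have "\<forall>\<^sub>F t in at_right 0. 1 / (a k \<bullet> w) = t / (a k \<bullet> r t + b k)"
        by (intro eventually_mono[OF evP]) simp
      then show ?thesis
        using True Lim_transform_eventually[OF tendsto_const] by simp
    next
      case False
      then have "a k \<bullet> v + b k \<noteq> 0"
        using k by (simp add: J_def)
      then have "((\<lambda>t. t / (a k \<bullet> r t + b k)) \<longlongrightarrow> 0 / (a k \<bullet> v + b k)) (at_right 0)"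
        by (intro tendsto_intros r0)
      then show ?thesis
        using False by simp
    qed
    then have "((\<lambda>t. (\<Sum>k\<in>I. ?e t k) + t * G i j (r t)) \<longlongrightarrow>
        (\<Sum>k\<in>I. a k $ i * a k $ j * (if k \<in> J then 1 / (a k \<bullet> w) else 0)) + 0 * G i j v) (at_right 0)"
      by (intro tendsto_intros along G)
    also have "(\<Sum>k\<in>I. a k $ i * a k $ j * (if k \<in> J then 1 / (a k \<bullet> w) else 0)) + 0 * G i j v
        = (\<Sum>k\<in>I. if k \<in> J then a k $ i * a k $ j / (a k \<bullet> w) else 0)"
      by (simp add: if_distrib cong: if_cong)
    also have "\<dots> = B $ i $ j"
      using fin by (simp add: B_def J_def sum.inter_filter)
    finally show "((\<lambda>t. (\<Sum>k\<in>I. ?e t k) + t * G i j (r t)) \<longlongrightarrow> B $ i $ j) (at_right 0)" .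
    show "\<forall>\<^sub>F t in at_right 0. (\<Sum>k\<in>I. ?e t k) + t * G i j (r t) = (t *\<^sub>R hessian u (r t)) $ i $ j"
      using evP by (rule eventually_mono) (simp add: H distrib_left sum_distrib_left mult_ac)
  qed
  then have "((\<lambda>t. det (t *\<^sub>R hessian u (r t))) \<longlongrightarrow> det B) (at_right 0)"
    by (rule tendsto_det)
  then have "((\<lambda>t. t ^ (card J - CARD('n)) * det (t *\<^sub>R hessian u (r t)))
      \<longlongrightarrow> 0 ^ (card J - CARD('n)) * det B) (at_right 0)"
    by (intro tendsto_intros)
  then have lhs: "((\<lambda>t. t ^ card J * det (hessian u (r t))) \<longlongrightarrow> 0) (at_right 0)"
    using less by (simp add: det_scaleR power_0_left flip: power_add mult.assoc)
  obtain c where "0 < c"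
    and c: "((\<lambda>t. (\<Prod>k\<in>I. a k \<bullet> r t + b k) / t ^ card J) \<longlongrightarrow> c) (at_right 0)"
    using tendsto_prod_affine_ray[OF fin, of a v b w J] vI p
    by (auto simp: J_def r_def w_def)
  have "((\<lambda>t. h (r t) / ((\<Prod>k\<in>I. a k \<bullet> r t + b k) / t ^ card J)) \<longlongrightarrow> h v / c) (at_right 0)"
    using \<open>0 < c\<close> by (intro tendsto_divide along h c) simp
  then have "((\<lambda>t. t ^ card J * det (hessian u (r t))) \<longlongrightarrow> h v / c) (at_right 0)"
    by (rule Lim_transform_eventually)
      (use evP in \<open>auto simp: MA mult.commute elim!: eventually_mono\<close>)
  then have "h v / c = 0"
    using lhs by (intro tendsto_unique[of "at_right 0"]) auto
  then show False
    using h(2) \<open>0 < c\<close> by simp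
qed

section \<open>Simplicity of the polytope\<close>

lemma card_facets_through_point:
  assumes bij: "bij_betw (\<lambda>i. {x \<in> S. l i x = 0}) I {F. F facet_of S}" and v: "v \<in> S"
  shows "card {F. F facet_of S \<and> v \<in> F} = card {i\<in>I. l i v = 0}"
proof -
  let ?f = "\<lambda>i. {x \<in> S. l i x = 0}"
  have "{F. F facet_of S \<and> v \<in> F} = ?f ` {i\<in>I. l i v = 0}"
    using bij_betw_imp_surj_on[OF bij] v by auto
  moreover have "inj_on ?f {i\<in>I. l i v = 0}"
    using bij_betw_imp_inj_on[OF bij] by (rule inj_on_subset) auto
  ultimately show ?thesis
    by (simp add: card_image)
qed

theorem proposition2p1:
  fixes P :: "(real ^ 'n) set"
    and N :: nat
    and l :: "nat \<Rightarrow> real ^ 'n \<Rightarrow> real"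
    and h :: "real ^ 'n \<Rightarrow> real"
  assumes "polytope_defined_by P N l"
    and "smooth_closure P h"
    and "\<forall>x\<in>closure P. h x > 0"
    and "\<exists>u :: real ^ 'n \<Rightarrow> real.
      (\<forall>x\<in>P. det (hessian u x) = h x / (\<Prod>i=1..N. l i x)) \<and>
      (\<exists>\<phi>. smooth_closure P \<phi> \<and>
        (\<forall>x\<in>P. u x - (\<Sum>i=1..N. l i x * ln (l i x)) = \<phi> x))"
  shows "simple_polytope (closure P)"
proof -
  have ne: "P \<noteq> {}" and poly: "polytope (closure P)"
    and bij: "bij_betw (\<lambda>i. {x \<in> closure P. l i x = 0}) {1..N} {F. F facet_of closure P}"
    using assms(1) by (auto simp: polytope_defined_by_def)
  have "\<forall>i\<in>{1..N}. \<exists>a b. \<forall>x. l i x = a \<bullet> x + b"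
    using assms(1) by (auto simp: polytope_defined_by_def affine_function_def)
  then obtain a b where l: "\<And>i x. i \<in> {1..N} \<Longrightarrow> l i x = a i \<bullet> x + b i"
    by metis
  have "P = (\<Inter>i\<in>{1..N}. {x. l i x > 0})"
    using assms(1) by (simp add: polytope_defined_by_def)
  then have P: "P = {x. \<forall>i\<in>{1..N}. 0 < a i \<bullet> x + b i}"
    by (auto simp: l)
  obtain u \<phi> where MA: "\<And>x. x \<in> P \<Longrightarrow> det (hessian u x) = h x / (\<Prod>i=1..N. l i x)"
    and \<phi>: "smooth_closure P \<phi>"
    and u: "\<And>x. x \<in> P \<Longrightarrow> u x - (\<Sum>i=1..N. l i x * ln (l i x)) = \<phi> x"
    using assms(4) by blast
  have "continuous_on (closure P) h"
    using assms(2) Ck_closure.simps(1) by (metis smooth_closure_def)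
  moreover have "u x = (\<Sum>i=1..N. (a i \<bullet> x + b i) * ln (a i \<bullet> x + b i)) + \<phi> x" if "x \<in> P" for x
    using u[OF that] by (simp add: l algebra_simps)
  moreover have "det (hessian u x) = h x / (\<Prod>i=1..N. a i \<bullet> x + b i)" if "x \<in> P" for x
    using MA[OF that] by (simp add: l)
  moreover have "Ck_closure 2 P \<phi>"
    using \<phi> by (simp add: smooth_closure_def)
  ultimately have le: "card {i\<in>{1..N}. a i \<bullet> v + b i = 0} \<le> CARD('n)" if "v \<in> closure P" for v
    using assms(3) that
    by (intro card_active_constraints_le_dim[OF finite_atLeastAtMost P ne that, of h \<phi> u]) blast+
  have "card {F. F facet_of closure P \<and> v \<in> F} = CARD('n)" if v: "v extreme_point_of closure P" for v
  proof -
    have vP: "v \<in> closure P"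
      using v by (simp add: extreme_point_of_def)
    have "{i\<in>{1..N}. l i v = 0} = {i\<in>{1..N}. a i \<bullet> v + b i = 0}"
      by (auto simp: l)
    then show ?thesis
      using dim_le_card_active_constraints[OF _ closure_open_polyhedron[OF P ne] v] le[OF vP]
        card_facets_through_point[OF bij vP]
      by simp
  qed
  moreover have "interior (closure P) \<noteq> {}"
  proof -
    have "open P"
      unfolding P by (intro open_strict_polyhedron finite_atLeastAtMost)
    then show ?thesis
      using ne interior_maximal[OF closure_subset] by blast
  qed
  ultimately show ?thesis
    using poly by (simp add: simple_polytope_def)
qed

end
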